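(* Let $\mathsf{C}$ be a category. Then: (1) $\nabla_{\mathsf{C}}=(\nabla_{\mathrm{Ob}(\mathsf{C})},\nabla_{\mathrm{Mor}(\mathsf{C})^{+}})$, where $\nabla_X=X\times X$, is a generalized congruence on $\mathsf{C}$, and it is the greatest one. (2) If $\mathcal{F}$ is a nonempty subset of $\mathrm{GCgr}(\mathsf{C})$, then $\bigcap\mathcal{F}\in\mathrm{GCgr}(\mathsf{C})$. (3) If $\mathcal{F}$ is a nonempty directed subset of $\mathrm{GCgr}(\mathsf{C})$, then $\bigcup\mathcal{F}\in\mathrm{GCgr}(\mathsf{C})$. Therefore $\mathrm{GCgr}(\mathsf{C})$, ordered by inclusion, is an algebraic lattice.
   Context: Let $\mathrm{sc}(f)$, $\mathrm{tg}(f)$ be the source and target of a morphism $f$, let $\mathrm{Mor}(\mathsf{C})^{+}$ be the set of finite nonempty sequences $(f_i)_{i\in m}=(f_0,\dots,f_{m-1})$ of morphisms of $\mathsf{C}$, let $(f)$ be the length-one sequence, and let $\curlywedge$ be concatenation. For an equivalence relation $E$ on $\mathrm{Ob}(\mathsf{C})$, $\mathrm{Mor}(\mathsf{C})^{+}_{E}$ is the set of $E$-composable sequences: those $(f_i)_{i\in m}$ with $(\mathrm{tg}(f_i),\mathrm{sc}(f_{i+1}))\in E$ for every $i\in m-1$. A generalized congruence on $\mathsf{C}$ is a pair $\Psi=(\Psi^{\mathrm{ob}},\Psi^{\mathrm{fl}})$ where $\Psi^{\mathrm{ob}}$ is an equivalence relation on $\mathrm{Ob}(\mathsf{C})$ and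 $\Psi^{\mathrm{fl}}$ is an equivalence relation on $\mathrm{Mor}(\mathsf{C})^{+}_{\Psi^{\mathrm{ob}}}$ such that: (a) if $(a,b)\in\Psi^{\mathrm{ob}}$, then $((\mathrm{id}_a),(\mathrm{id}_b))\in\Psi^{\mathrm{fl}}$; (b) if $((f_i)_{i\in m},(g_j)_{j\in n})\in\Psi^{\mathrm{fl}}$, then $(\mathrm{sc}(f_0),\mathrm{sc}(g_0))\in\Psi^{\mathrm{ob}}$ and $(\mathrm{tg}(f_{m-1}),\mathrm{tg}(g_{n-1}))\in\Psi^{\mathrm{ob}}$; (c) if $\mathrm{sc}(g)=\mathrm{tg}(f)$, then $((f,g),(g\circ f))\in\Psi^{\mathrm{fl}}$; (d) if $((f_i)_{i\in m},(f'_{i'})_{i'\in m'}),((g_j)_{j\in n},(g'_{j'})_{j'\in n'})\in\Psi^{\mathrm{fl}}$ and $(\mathrm{tg}(f_{m-1}),\mathrm{sc}(g_0))\in\Psi^{\mathrm{ob}}$, then $((f_i)_{i\in m}\curlywedge(g_j)_{j\in n},(f'_{i'})_{i'\in m'}\curlywedge(g'_{j'})_{j'\in n'})\in\Psi^{\mathrm{fl}}$. $\mathrm{GCgr}(\mathsf{C})$ is the set of all generalized congruences on $\mathsf{C}$. Inclusion, unions and intersections are coordinatewise. *)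

theory Defs
  imports
    "HOL-Algebra.Complete_Lattice"
    "HOL-Library.Product_Order"
begin

text \<open>Small categories. The value \<open>cmp C g f\<close> is the composite \<open>g \<circ> f\<close>; it is only
  constrained when \<open>sc C g = tg C f\<close>.\<close>

record ('o, 'm) category_data =
  Ob :: "'o set"
  Mor :: "'m set"
  sc :: "'m \<Rightarrow> 'o"
  tg :: "'m \<Rightarrow> 'o"
  ident :: "'o \<Rightarrow> 'm"
  cmp :: "'m \<Rightarrow> 'm \<Rightarrow> 'm"

locale category =
  fixes C :: "('o, 'm, 'x) category_data_scheme"
  assumes sc_in_Ob: "f \<in> Mor C \<Longrightarrow> sc C f \<in> Ob C"
    and tg_in_Ob: "f \<in> Mor C \<Longrightarrow> tg C f \<in> Ob C"
    and ident_in_Mor: "a \<in> Ob C \<Longrightarrow> ident C a \<in> Mor C"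
    and sc_ident: "a \<in> Ob C \<Longrightarrow> sc C (ident C a) = a"
    and tg_ident: "a \<in> Ob C \<Longrightarrow> tg C (ident C a) = a"
    and cmp_in_Mor: "\<lbrakk>f \<in> Mor C; g \<in> Mor C; sc C g = tg C f\<rbrakk> \<Longrightarrow> cmp C g f \<in> Mor C"
    and sc_cmp: "\<lbrakk>f \<in> Mor C; g \<in> Mor C; sc C g = tg C f\<rbrakk> \<Longrightarrow> sc C (cmp C g f) = sc C f"
    and tg_cmp: "\<lbrakk>f \<in> Mor C; g \<in> Mor C; sc C g = tg C f\<rbrakk> \<Longrightarrow> tg C (cmp C g f) = tg C g"
    and cmp_ident_right: "f \<in> Mor C \<Longrightarrow> cmp C f (ident C (sc C f)) = f"
    and cmp_ident_left: "f \<in> Mor C \<Longrightarrow> cmp C (ident C (tg C f)) f = f"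
    and cmp_assoc:
      "\<lbrakk>f \<in> Mor C; g \<in> Mor C; h \<in> Mor C; sc C g = tg C f; sc C h = tg C g\<rbrakk>
        \<Longrightarrow> cmp C (cmp C h g) f = cmp C h (cmp C g f)"

definition Mor_plus :: "('o, 'm, 'x) category_data_scheme \<Rightarrow> 'm list set" where
  "Mor_plus C = {fs. fs \<noteq> [] \<and> set fs \<subseteq> Mor C}"

definition Mor_plus_on ::
    "('o, 'm, 'x) category_data_scheme \<Rightarrow> ('o \<times> 'o) set \<Rightarrow> 'm list set" where
  "Mor_plus_on C E =
    {fs \<in> Mor_plus C. \<forall>i < length fs - 1. (tg C (fs ! i), sc C (fs ! Suc i)) \<in> E}"

type_synonym ('o, 'm) rel_pair = "('o \<times> 'o) set \<times> ('m list \<times> 'm list) set"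

text \<open>In the last two clauses, membership of the sequences in
  \<open>Mor_plus_on C (fst \<Psi>)\<close>, and hence their nonemptiness, comes from the second
  \<open>equiv\<close>, which includes \<open>snd \<Psi> \<subseteq> Mor_plus_on C (fst \<Psi>) \<times> Mor_plus_on C (fst \<Psi>)\<close>.\<close>

definition gen_congruence ::
    "('o, 'm, 'x) category_data_scheme \<Rightarrow> ('o, 'm) rel_pair \<Rightarrow> bool" where
  "gen_congruence C \<Psi> \<longleftrightarrow>
    equiv (Ob C) (fst \<Psi>) \<and>
    equiv (Mor_plus_on C (fst \<Psi>)) (snd \<Psi>) \<and>
    (\<forall>a b. (a, b) \<in> fst \<Psi> \<longrightarrow> ([ident C a], [ident C b]) \<in> snd \<Psi>) \<and>
    (\<forall>f \<in> Mor C. \<forall>g \<in> Mor C. sc C g = tg C f \<longrightarrow> ([f, g], [cmp C g f]) \<in> snd \<Psi>) \<and>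
    (\<forall>fs gs. (fs, gs) \<in> snd \<Psi> \<longrightarrow>
      (sc C (hd fs), sc C (hd gs)) \<in> fst \<Psi> \<and>
      (tg C (last fs), tg C (last gs)) \<in> fst \<Psi>) \<and>
    (\<forall>fs fs' gs gs'. (fs, fs') \<in> snd \<Psi> \<and> (gs, gs') \<in> snd \<Psi> \<and>
      (tg C (last fs), sc C (hd gs)) \<in> fst \<Psi> \<longrightarrow> (fs @ gs, fs' @ gs') \<in> snd \<Psi>)"

definition GCgr :: "('o, 'm, 'x) category_data_scheme \<Rightarrow> ('o, 'm) rel_pair set" where
  "GCgr C = {\<Psi>. gen_congruence C \<Psi>}"

text \<open>On pairs of relations, the order \<open>(\<le>)\<close> and the operations \<open>Inf\<close> and \<open>Sup\<close> from
  \<^theory>\<open>HOL-Library.Product_Order\<close> are coordinatewise inclusion, intersection and union.\<close>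

definition GCgr_order :: "('o, 'm, 'x) category_data_scheme \<Rightarrow> ('o, 'm) rel_pair gorder" where
  "GCgr_order C = \<lparr>carrier = GCgr C, eq = (=), le = (\<le>)\<rparr>"

definition nabla :: "('o, 'm, 'x) category_data_scheme \<Rightarrow> ('o, 'm) rel_pair" where
  "nabla C = (Ob C \<times> Ob C, Mor_plus C \<times> Mor_plus C)"

definition directed :: "'a::order set \<Rightarrow> bool" where
  "directed A \<longleftrightarrow> A \<noteq> {} \<and> (\<forall>x \<in> A. \<forall>y \<in> A. \<exists>z \<in> A. x \<le> z \<and> y \<le> z)"

text \<open>Algebraic lattices: complete lattices in which every element is a join of compact
  elements. The operation \<open>\<Squnion>\<^bsub>L\<^esub>\<close> is the join in \<open>L\<close>, which for \<open>GCgr_order C\<close> need not be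
  the coordinatewise union.\<close>

definition compact_element :: "('a, 'b) gorder_scheme \<Rightarrow> 'a \<Rightarrow> bool" where
  "compact_element L k \<longleftrightarrow> k \<in> carrier L \<and>
    (\<forall>A. A \<subseteq> carrier L \<and> k \<sqsubseteq>\<^bsub>L\<^esub> \<Squnion>\<^bsub>L\<^esub>A \<longrightarrow> (\<exists>B. finite B \<and> B \<subseteq> A \<and> k \<sqsubseteq>\<^bsub>L\<^esub> \<Squnion>\<^bsub>L\<^esub>B))"

locale algebraic_lattice = complete_lattice L for L (structure) +
  assumes compactly_generated:
    "x \<in> carrier L \<Longrightarrow> \<exists>K. K \<subseteq> {k. compact_element L k} \<and> x = \<Squnion>\<^bsub>L\<^esub>K"

end

theory Submission
  imports Defs
begin

text \<open>
  Each clause in the definition of a generalized congruence has the form ``if certain finitely many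
  pairs belong to \<open>\<Psi>\<close>, then so does another pair'', apart from the requirement that \<open>\<Psi>\<close> lie below
  \<open>\<nabla>\<close>. The generalized congruences are therefore the closed sets of a finitary closure system with
  greatest member \<open>\<nabla>\<close>: clauses of this form pass to intersections, and they pass to directed unions
  because the finitely many premises already occur together in one member. The one point that needs
  care is that \<open>\<Psi>\<^sup>f\<^sup>l\<close> is an equivalence relation on a set that varies with \<open>\<Psi>\<^sup>o\<^sup>b\<close>. But a sequence has
  only finitely many junctions, so the formation of \<open>Mor_plus_on C E\<close> commutes with intersections and
  with directed unions of \<open>E\<close> (\<open>Mor_plus_on_Inter\<close>, \<open>Mor_plus_on_directed_Union\<close>).

  The passage to algebraic lattices is purely order-theoretic (\<open>algebraic_latticeI\<close>). Let \<open>S\<close> be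
  a subset of a complete lattice that has a greatest element and is closed under nonempty infima and
  directed suprema. For an element \<open>k\<close> below some member of \<open>S\<close>, let \<open>c k\<close> be the least member of
  \<open>S\<close> above \<open>k\<close>. If \<open>k\<close> is inaccessible by directed suprema in the ambient lattice, then \<open>c k\<close> is
  compact in \<open>S\<close>, since the join of \<open>A\<close> in \<open>S\<close> is the ambient supremum of the directed family of joins
  of finite subsets of \<open>A\<close>. When every element of the ambient lattice is a supremum of such \<open>k\<close>,
  every member of \<open>S\<close> is a join of elements \<open>c k\<close>. For pairs of relations, the elements \<open>k\<close> are the
  pairs of relations having exactly one related pair in all, and \<open>c k\<close> is a principal generalized
  congruence.
\<close>

section \<open>Directed families\<close>

lemma directed_finite_upper_bound:
  assumes "directed D" "finite F" "F \<subseteq> D"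
  shows "\<exists>z\<in>D. \<forall>x\<in>F. x \<le> z"
  using assms(2,3)
proof (induction F)
  case empty
  then show ?case using assms(1) by (auto simp: directed_def)
next
  case (insert x F)
  then obtain z where z: "z \<in> D" "\<forall>y\<in>F. y \<le> z" by auto
  obtain w where "w \<in> D" "x \<le> w" "z \<le> w"
    using assms(1) insert.prems z(1) unfolding directed_def by blast
  then show ?case using z(2) by (intro bexI[of _ w]) (auto intro: order_trans)
qed

text \<open>Choosing a member for each point of \<open>P\<close> gives a finite subset of \<open>D\<close>, and an upper bound of it
  in \<open>D\<close> serves for all points at once; this is what makes finitary conditions pass to directed
  unions.\<close>

lemma finite_subset_directed_UN:
  fixes r :: "'a::order \<Rightarrow> 'b set"
  assumes "directed D" "mono r" "finite P" "P \<subseteq> (\<Union>d\<in>D. r d)"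
  shows "\<exists>d\<in>D. P \<subseteq> r d"
proof -
  have "\<forall>p\<in>P. \<exists>d\<in>D. p \<in> r d" using assms(4) by blast
  then obtain h where h: "\<And>p. p \<in> P \<Longrightarrow> h p \<in> D" "\<And>p. p \<in> P \<Longrightarrow> p \<in> r (h p)" by metis
  obtain z where "z \<in> D" "\<forall>x\<in>h ` P. x \<le> z"
    using directed_finite_upper_bound[OF assms(1), of "h ` P"] assms(3) h(1) by blast
  then show ?thesis using h(2) monoD[OF assms(2)] by (intro bexI[of _ z]) blast+
qed

section \<open>Algebraic lattices from closure systems\<close>

lemma complete_latticeI_closure_system:
  fixes S :: "'a::complete_lattice set"
  assumes greatest: "t \<in> S" "\<And>x. x \<in> S \<Longrightarrow> x \<le> t"
    and Inf_closed: "\<And>F. F \<noteq> {} \<Longrightarrow> F \<subseteq> S \<Longrightarrow> Inf F \<in> S"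
  shows "Complete_Lattice.complete_lattice \<lparr>carrier = S, eq = (=), le = (\<le>)\<rparr>"
    (is "Complete_Lattice.complete_lattice ?L")
proof -
  interpret L: partial_order ?L
    by unfold_locales (auto intro: order_trans)
  show ?thesis
  proof (rule L.complete_lattice_criterion1)
    show "\<exists>g. greatest ?L g (carrier ?L)"
      using greatest by (auto simp: greatest_def)
    show "\<exists>i. greatest ?L i (Lower ?L A)" if "A \<subseteq> carrier ?L" "A \<noteq> {}" for A
      using that Inf_closed[of A]
      by (intro exI[of _ "Inf A"])
        (auto simp: greatest_def Lower_def subset_iff intro: Inf_lower Inf_greatest)
  qed
qed

text \<open>An element of \<open>K\<close> below the supremum of the directed family of finite joins lies below one of
  them, and then so does its closure; hence the closures of elements of \<open>K\<close> are compact. The closures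
  of those elements of \<open>K\<close> that lie below \<open>x\<close> have join \<open>x\<close>.\<close>

lemma algebraic_latticeI:
  fixes S K :: "'a::complete_lattice set"
  assumes greatest: "t \<in> S" "\<And>x. x \<in> S \<Longrightarrow> x \<le> t"
    and Inf_closed: "\<And>F. F \<noteq> {} \<Longrightarrow> F \<subseteq> S \<Longrightarrow> Inf F \<in> S"
    and Sup_closed: "\<And>D. directed D \<Longrightarrow> D \<subseteq> S \<Longrightarrow> Sup D \<in> S"
    and inaccessible: "\<And>k D. k \<in> K \<Longrightarrow> directed D \<Longrightarrow> k \<le> Sup D \<Longrightarrow> \<exists>d\<in>D. k \<le> d"
    and generating: "\<And>x. x \<in> S \<Longrightarrow> x \<le> Sup {k \<in> K. k \<le> x}"
  shows "algebraic_lattice \<lparr>carrier = S, eq = (=), le = (\<le>)\<rparr>"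
    (is "algebraic_lattice ?L")
proof -
  interpret L: Complete_Lattice.complete_lattice ?L
    by (rule complete_latticeI_closure_system[OF greatest Inf_closed])
  have sup_in: "\<Squnion>\<^bsub>?L\<^esub>A \<in> S" if "A \<subseteq> S" for A
    using L.weak.sup_closed[of A] that by simp
  have sup_ub: "x \<le> \<Squnion>\<^bsub>?L\<^esub>A" if "A \<subseteq> S" "x \<in> A" for A x
    using L.weak.sup_upper[of A x] that by simp
  have sup_least: "\<Squnion>\<^bsub>?L\<^esub>A \<le> z" if "A \<subseteq> S" "z \<in> S" "\<And>x. x \<in> A \<Longrightarrow> x \<le> z" for A z
    using L.weak.sup_least[of A z] that by simp
  define c where "c k = Inf {s \<in> S. k \<le> s}" for k
  have c_in: "c k \<in> S" if "k \<le> s" "s \<in> S" for k s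
    unfolding c_def using that by (intro Inf_closed) auto
  have c_ub: "k \<le> c k" for k
    unfolding c_def by (auto intro: Inf_greatest)
  have c_least: "c k \<le> s" if "k \<le> s" "s \<in> S" for k s
    unfolding c_def using that by (auto intro: Inf_lower)

  have compact: "compact_element ?L (c k)" if k: "k \<in> K" "k \<le> s" "s \<in> S" for k s
    unfolding compact_element_def
  proof (intro conjI allI impI)
    show "c k \<in> carrier ?L" using c_in[OF k(2,3)] by simp
  next
    fix A assume "A \<subseteq> carrier ?L \<and> c k \<sqsubseteq>\<^bsub>?L\<^esub> \<Squnion>\<^bsub>?L\<^esub>A"
    then have A: "A \<subseteq> S" and le: "c k \<le> \<Squnion>\<^bsub>?L\<^esub>A" by auto
    define D where "D = (\<lambda>B. \<Squnion>\<^bsub>?L\<^esub>B) ` {B. finite B \<and> B \<subseteq> A}"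
    have D: "D \<subseteq> S" unfolding D_def using sup_in A by blast
    have "directed D"
      unfolding directed_def
    proof (intro conjI ballI)
      show "D \<noteq> {}" unfolding D_def by blast
    next
      fix x y assume "x \<in> D" "y \<in> D"
      then obtain B B' where B: "finite B" "B \<subseteq> A" "x = \<Squnion>\<^bsub>?L\<^esub>B"
        and B': "finite B'" "B' \<subseteq> A" "y = \<Squnion>\<^bsub>?L\<^esub>B'" unfolding D_def by blast
      have BS: "B \<subseteq> S" "B' \<subseteq> S" "B \<union> B' \<subseteq> S" using A B(2) B'(2) by auto
      have "x \<le> \<Squnion>\<^bsub>?L\<^esub>(B \<union> B')" "y \<le> \<Squnion>\<^bsub>?L\<^esub>(B \<union> B')"
        unfolding B(3) B'(3)
        using sup_least[OF BS(1) sup_in[OF BS(3)]] sup_least[OF BS(2) sup_in[OF BS(3)]]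
          sup_ub[OF BS(3)] by blast+
      moreover have "\<Squnion>\<^bsub>?L\<^esub>(B \<union> B') \<in> D"
        unfolding D_def using B(1,2) B'(1,2) by (intro imageI) simp
      ultimately show "\<exists>z\<in>D. x \<le> z \<and> y \<le> z" by blast
    qed
    have "\<Squnion>\<^bsub>?L\<^esub>A \<le> Sup D"
    proof (rule sup_least[OF A Sup_closed[OF \<open>directed D\<close> D]])
      fix a assume a: "a \<in> A"
      then have "a \<le> \<Squnion>\<^bsub>?L\<^esub>{a}" using A by (intro sup_ub) auto
      also have "\<dots> \<le> Sup D"
        unfolding D_def using a by (intro Sup_upper imageI) simp
      finally show "a \<le> Sup D" .
    qed
    with le c_ub[of k] have "k \<le> Sup D" by (meson order_trans)
    then obtain d where "d \<in> D" "k \<le> d" using inaccessible[OF k(1) \<open>directed D\<close>] by blast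
    then obtain B where B: "finite B" "B \<subseteq> A" "k \<le> \<Squnion>\<^bsub>?L\<^esub>B" unfolding D_def by blast
    have "c k \<le> \<Squnion>\<^bsub>?L\<^esub>B"
      using B A by (intro c_least sup_in) auto
    then show "\<exists>B. finite B \<and> B \<subseteq> A \<and> c k \<sqsubseteq>\<^bsub>?L\<^esub> \<Squnion>\<^bsub>?L\<^esub>B" using B by auto
  qed

  show ?thesis
  proof unfold_locales
    fix x assume "x \<in> carrier ?L"
    then have x: "x \<in> S" by simp
    define G where "G = c ` {k \<in> K. k \<le> x}"
    have G: "G \<subseteq> S" unfolding G_def using c_in x by auto
    have "x \<le> Sup {k \<in> K. k \<le> x}" by (rule generating[OF x])
    also have "\<dots> \<le> \<Squnion>\<^bsub>?L\<^esub>G"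
    proof (rule Sup_least)
      fix k assume "k \<in> {k \<in> K. k \<le> x}"
      then have "c k \<le> \<Squnion>\<^bsub>?L\<^esub>G" by (intro sup_ub[OF G]) (simp add: G_def)
      then show "k \<le> \<Squnion>\<^bsub>?L\<^esub>G" using c_ub order_trans by blast
    qed
    finally have "x \<le> \<Squnion>\<^bsub>?L\<^esub>G" .
    moreover have "\<Squnion>\<^bsub>?L\<^esub>G \<le> x"
    proof (rule sup_least[OF G x])
      fix y assume "y \<in> G"
      then obtain k where "k \<le> x" "y = c k" unfolding G_def by blast
      then show "y \<le> x" using c_least[OF _ x] by simp
    qed
    ultimately have "x = \<Squnion>\<^bsub>?L\<^esub>G" by (rule order.antisym)
    moreover have "G \<subseteq> {k. compact_element ?L k}"
    proof
      fix y assume "y \<in> G"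
      then obtain k where "k \<in> K" "k \<le> x" "y = c k" unfolding G_def by blast
      then show "y \<in> {k. compact_element ?L k}" using compact[OF _ _ x] by simp
    qed
    ultimately show "\<exists>K. K \<subseteq> {k. compact_element ?L k} \<and> x = \<Squnion>\<^bsub>?L\<^esub>K"
      by (intro exI[of _ G] conjI)
  qed
qed

section \<open>Composable sequences\<close>

lemma Mor_plus_on_Inter:
  assumes "F \<noteq> {}"
  shows "Mor_plus_on C (\<Inter>x\<in>F. E x) = (\<Inter>x\<in>F. Mor_plus_on C (E x))"
  using assms by (auto simp: Mor_plus_on_def)

lemma Mor_plus_on_mono: "E \<subseteq> E' \<Longrightarrow> Mor_plus_on C E \<subseteq> Mor_plus_on C E'"
  by (auto simp: Mor_plus_on_def)

text \<open>The finitely many junctions of a sequence that is composable for the union are all related in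
  a single member of the family.\<close>

lemma Mor_plus_on_directed_Union:
  assumes "directed D" "mono r"
  shows "Mor_plus_on C (\<Union>d\<in>D. r d) = (\<Union>d\<in>D. Mor_plus_on C (r d))"
proof
  show "Mor_plus_on C (\<Union>d\<in>D. r d) \<subseteq> (\<Union>d\<in>D. Mor_plus_on C (r d))"
  proof
    fix fs assume fs: "fs \<in> Mor_plus_on C (\<Union>d\<in>D. r d)"
    define P where "P = (\<lambda>i. (tg C (fs ! i), sc C (fs ! Suc i))) ` {..<length fs - 1}"
    have "\<exists>d\<in>D. P \<subseteq> r d"
    proof (rule finite_subset_directed_UN[OF assms])
      show "finite P" by (simp add: P_def)
      show "P \<subseteq> (\<Union>d\<in>D. r d)"
        using fs unfolding P_def Mor_plus_on_def by blast
    qed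
    then show "fs \<in> (\<Union>d\<in>D. Mor_plus_on C (r d))"
      using fs unfolding P_def Mor_plus_on_def by blast
  qed
  show "(\<Union>d\<in>D. Mor_plus_on C (r d)) \<subseteq> Mor_plus_on C (\<Union>d\<in>D. r d)"
    using Mor_plus_on_mono[of _ "\<Union>d\<in>D. r d" C] by blast
qed

lemma ends_in_Mor:
  assumes "fs \<in> Mor_plus C"
  shows "hd fs \<in> Mor C" "last fs \<in> Mor C"
  using assms by (auto simp: Mor_plus_def subset_iff)

section \<open>Generalized congruences as a closure system\<close>

lemma gen_congruenceD:
  assumes "gen_congruence C \<Psi>"
  shows "(a, b) \<in> fst \<Psi> \<Longrightarrow> a \<in> Ob C \<and> b \<in> Ob C"
    and "a \<in> Ob C \<Longrightarrow> (a, a) \<in> fst \<Psi>"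
    and "(a, b) \<in> fst \<Psi> \<Longrightarrow> (b, a) \<in> fst \<Psi>"
    and "(a, b) \<in> fst \<Psi> \<Longrightarrow> (b, d) \<in> fst \<Psi> \<Longrightarrow> (a, d) \<in> fst \<Psi>"
    and "(fs, gs) \<in> snd \<Psi> \<Longrightarrow> fs \<in> Mor_plus_on C (fst \<Psi>) \<and> gs \<in> Mor_plus_on C (fst \<Psi>)"
    and "fs \<in> Mor_plus_on C (fst \<Psi>) \<Longrightarrow> (fs, fs) \<in> snd \<Psi>"
    and "(fs, gs) \<in> snd \<Psi> \<Longrightarrow> (gs, fs) \<in> snd \<Psi>"
    and "(fs, gs) \<in> snd \<Psi> \<Longrightarrow> (gs, hs) \<in> snd \<Psi> \<Longrightarrow> (fs, hs) \<in> snd \<Psi>"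
    and "(a, b) \<in> fst \<Psi> \<Longrightarrow> ([ident C a], [ident C b]) \<in> snd \<Psi>"
    and "f \<in> Mor C \<Longrightarrow> g \<in> Mor C \<Longrightarrow> sc C g = tg C f \<Longrightarrow> ([f, g], [cmp C g f]) \<in> snd \<Psi>"
    and "(fs, gs) \<in> snd \<Psi> \<Longrightarrow> (sc C (hd fs), sc C (hd gs)) \<in> fst \<Psi>"
    and "(fs, gs) \<in> snd \<Psi> \<Longrightarrow> (tg C (last fs), tg C (last gs)) \<in> fst \<Psi>"
    and "(fs, fs') \<in> snd \<Psi> \<Longrightarrow> (gs, gs') \<in> snd \<Psi> \<Longrightarrow> (tg C (last fs), sc C (hd gs)) \<in> fst \<Psi> \<Longrightarrow>
      (fs @ gs, fs' @ gs') \<in> snd \<Psi>"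
proof -
  have eqs: "equiv (Ob C) (fst \<Psi>)" "equiv (Mor_plus_on C (fst \<Psi>)) (snd \<Psi>)"
    using assms by (simp_all add: gen_congruence_def)
  show "(a, b) \<in> fst \<Psi> \<Longrightarrow> a \<in> Ob C \<and> b \<in> Ob C"
    and "(fs, gs) \<in> snd \<Psi> \<Longrightarrow> fs \<in> Mor_plus_on C (fst \<Psi>) \<and> gs \<in> Mor_plus_on C (fst \<Psi>)"
    using eqs unfolding equiv_def by blast+
  show "a \<in> Ob C \<Longrightarrow> (a, a) \<in> fst \<Psi>"
    and "fs \<in> Mor_plus_on C (fst \<Psi>) \<Longrightarrow> (fs, fs) \<in> snd \<Psi>"
    using eqs by (simp_all add: equiv_def refl_on_def)
  show "(a, b) \<in> fst \<Psi> \<Longrightarrow> (b, a) \<in> fst \<Psi>" and "(fs, gs) \<in> snd \<Psi> \<Longrightarrow> (gs, fs) \<in> snd \<Psi>"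
    using eqs by (simp_all add: equiv_def symD)
  show "(a, b) \<in> fst \<Psi> \<Longrightarrow> (b, d) \<in> fst \<Psi> \<Longrightarrow> (a, d) \<in> fst \<Psi>"
    using eqs(1) unfolding equiv_def by (meson transD)
  show "(fs, gs) \<in> snd \<Psi> \<Longrightarrow> (gs, hs) \<in> snd \<Psi> \<Longrightarrow> (fs, hs) \<in> snd \<Psi>"
    using eqs(2) unfolding equiv_def by (meson transD)
qed (use assms in \<open>unfold gen_congruence_def, blast+\<close>)

lemma gen_congruenceI:
  assumes "\<And>a b. (a, b) \<in> R \<Longrightarrow> a \<in> Ob C \<and> b \<in> Ob C"
    and "\<And>a. a \<in> Ob C \<Longrightarrow> (a, a) \<in> R"
    and "\<And>a b. (a, b) \<in> R \<Longrightarrow> (b, a) \<in> R"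
    and "\<And>a b d. (a, b) \<in> R \<Longrightarrow> (b, d) \<in> R \<Longrightarrow> (a, d) \<in> R"
    and "\<And>fs gs. (fs, gs) \<in> Q \<Longrightarrow> fs \<in> Mor_plus_on C R \<and> gs \<in> Mor_plus_on C R"
    and "\<And>fs. fs \<in> Mor_plus_on C R \<Longrightarrow> (fs, fs) \<in> Q"
    and "\<And>fs gs. (fs, gs) \<in> Q \<Longrightarrow> (gs, fs) \<in> Q"
    and "\<And>fs gs hs. (fs, gs) \<in> Q \<Longrightarrow> (gs, hs) \<in> Q \<Longrightarrow> (fs, hs) \<in> Q"
    and "\<And>a b. (a, b) \<in> R \<Longrightarrow> ([ident C a], [ident C b]) \<in> Q"
    and "\<And>f g. f \<in> Mor C \<Longrightarrow> g \<in> Mor C \<Longrightarrow> sc C g = tg C f \<Longrightarrow> ([f, g], [cmp C g f]) \<in> Q"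
    and "\<And>fs gs. (fs, gs) \<in> Q \<Longrightarrow> (sc C (hd fs), sc C (hd gs)) \<in> R"
    and "\<And>fs gs. (fs, gs) \<in> Q \<Longrightarrow> (tg C (last fs), tg C (last gs)) \<in> R"
    and "\<And>fs fs' gs gs'. (fs, fs') \<in> Q \<Longrightarrow> (gs, gs') \<in> Q \<Longrightarrow>
      (tg C (last fs), sc C (hd gs)) \<in> R \<Longrightarrow> (fs @ gs, fs' @ gs') \<in> Q"
  shows "gen_congruence C (R, Q)"
proof -
  have "equiv (Ob C) R"
    by (intro equivI subrelI refl_onI symI transI)
      (simp add: assms(1,2) | erule assms(3) | erule (1) assms(4))+
  moreover have "equiv (Mor_plus_on C R) Q"
    by (intro equivI subrelI refl_onI symI transI)
      (simp add: assms(5,6) | erule assms(7) | erule (1) assms(8))+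
  ultimately show ?thesis
    unfolding gen_congruence_def fst_conv snd_conv by (simp add: assms(9-13))
qed

lemma nabla_gen_congruence:
  assumes "category C"
  shows "gen_congruence C (nabla C)"
proof -
  interpret category C by fact
  have eq: "Mor_plus_on C (Ob C \<times> Ob C) = Mor_plus C"
    by (auto simp: Mor_plus_on_def Mor_plus_def subset_iff intro!: tg_in_Ob sc_in_Ob)
  show ?thesis
    unfolding nabla_def
  proof (rule gen_congruenceI, unfold eq)
    fix fs gs assume "(fs, gs) \<in> Mor_plus C \<times> Mor_plus C"
    then show "(sc C (hd fs), sc C (hd gs)) \<in> Ob C \<times> Ob C"
      and "(tg C (last fs), tg C (last gs)) \<in> Ob C \<times> Ob C"
      by (auto intro: ends_in_Mor sc_in_Ob tg_in_Ob)
  qed (auto simp: Mor_plus_def intro: ident_in_Mor cmp_in_Mor)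
qed

lemma gen_congruence_le_nabla:
  assumes "gen_congruence C \<Psi>"
  shows "\<Psi> \<le> nabla C"
proof -
  have "Mor_plus_on C (fst \<Psi>) \<subseteq> Mor_plus C" by (auto simp: Mor_plus_on_def)
  then show ?thesis
    using gen_congruenceD(1,5)[OF assms] by (fastforce simp: nabla_def less_eq_prod_def)
qed

lemma Inf_gen_congruence:
  assumes "F \<noteq> {}" and F: "\<And>\<Psi>. \<Psi> \<in> F \<Longrightarrow> gen_congruence C \<Psi>"
  shows "gen_congruence C (Inf F)"
proof -
  note D = gen_congruenceD[OF F] and ne = assms(1)
  show ?thesis
    unfolding Inf_prod_def
  proof (rule gen_congruenceI, unfold Mor_plus_on_Inter[OF ne])
    show "a \<in> Ob C \<and> b \<in> Ob C" if "(a, b) \<in> \<Inter> (fst ` F)" for a b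
      using that ne D(1)[of _ a b] by blast
    show "(a, a) \<in> \<Inter> (fst ` F)" if "a \<in> Ob C" for a
      using that D(2)[of _ a] by blast
    show "(b, a) \<in> \<Inter> (fst ` F)" if "(a, b) \<in> \<Inter> (fst ` F)" for a b
      using that D(3)[of _ a b] by blast
    show "(a, d) \<in> \<Inter> (fst ` F)"
      if "(a, b) \<in> \<Inter> (fst ` F)" "(b, d) \<in> \<Inter> (fst ` F)" for a b d
      using that D(4)[of _ a b d] by blast
    show "fs \<in> (\<Inter>\<Psi>\<in>F. Mor_plus_on C (fst \<Psi>)) \<and> gs \<in> (\<Inter>\<Psi>\<in>F. Mor_plus_on C (fst \<Psi>))"
      if "(fs, gs) \<in> \<Inter> (snd ` F)" for fs gs
      using that D(5)[of _ fs gs] by blast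
    show "(fs, fs) \<in> \<Inter> (snd ` F)"
      if "fs \<in> (\<Inter>\<Psi>\<in>F. Mor_plus_on C (fst \<Psi>))" for fs
      using that D(6)[of _ fs] by blast
    show "(gs, fs) \<in> \<Inter> (snd ` F)" if "(fs, gs) \<in> \<Inter> (snd ` F)" for fs gs
      using that D(7)[of _ fs gs] by blast
    show "(fs, hs) \<in> \<Inter> (snd ` F)"
      if "(fs, gs) \<in> \<Inter> (snd ` F)" "(gs, hs) \<in> \<Inter> (snd ` F)" for fs gs hs
      using that D(8)[of _ fs gs hs] by blast
    show "([ident C a], [ident C b]) \<in> \<Inter> (snd ` F)"
      if "(a, b) \<in> \<Inter> (fst ` F)" for a b
      using that D(9)[of _ a b] by blast
    show "([f, g], [cmp C g f]) \<in> \<Inter> (snd ` F)"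
      if "f \<in> Mor C" "g \<in> Mor C" "sc C g = tg C f" for f g
      using that D(10)[of _ f g] by blast
    show "(sc C (hd fs), sc C (hd gs)) \<in> \<Inter> (fst ` F)"
      if "(fs, gs) \<in> \<Inter> (snd ` F)" for fs gs
      using that D(11)[of _ fs gs] by blast
    show "(tg C (last fs), tg C (last gs)) \<in> \<Inter> (fst ` F)"
      if "(fs, gs) \<in> \<Inter> (snd ` F)" for fs gs
      using that D(12)[of _ fs gs] by blast
    show "(fs @ gs, fs' @ gs') \<in> \<Inter> (snd ` F)"
      if "(fs, fs') \<in> \<Inter> (snd ` F)" "(gs, gs') \<in> \<Inter> (snd ` F)"
        "(tg C (last fs), sc C (hd gs)) \<in> \<Inter> (fst ` F)" for fs fs' gs gs'
      using that D(13)[of _ fs fs' gs gs'] by blast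
  qed
qed

text \<open>The composability of sequences passes to the union by \<open>Mor_plus_on_directed_Union\<close>. Each other
  clause has at most three membership premises, so for a directed family they hold jointly in one
  member, and the clause for that member applies.\<close>

lemma Sup_directed_gen_congruence:
  assumes "directed F" and F: "\<And>\<Psi>. \<Psi> \<in> F \<Longrightarrow> gen_congruence C \<Psi>"
  shows "gen_congruence C (Sup F)"
proof -
  note D = gen_congruenceD[OF F]
  have m: "mono (fst :: ('a, 'b) rel_pair \<Rightarrow> _)" "mono (snd :: ('a, 'b) rel_pair \<Rightarrow> _)"
    by (auto simp: mono_def less_eq_prod_def)
  have ne: "F \<noteq> {}" using assms(1) by (simp add: directed_def)
  have joint: "\<exists>\<Psi>\<in>F. P \<subseteq> fst \<Psi> \<and> Q \<subseteq> snd \<Psi>"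
    if P: "finite P" "P \<subseteq> \<Union> (fst ` F)" and Q: "finite Q" "Q \<subseteq> \<Union> (snd ` F)" for P Q
  proof -
    obtain \<Phi> \<Psi> where "\<Phi> \<in> F" "P \<subseteq> fst \<Phi>" "\<Psi> \<in> F" "Q \<subseteq> snd \<Psi>"
      using finite_subset_directed_UN[OF assms(1) m(1) P] finite_subset_directed_UN[OF assms(1) m(2) Q]
      by blast
    moreover from this obtain \<Theta> where "\<Theta> \<in> F" "\<Phi> \<le> \<Theta>" "\<Psi> \<le> \<Theta>"
      using assms(1) unfolding directed_def by blast
    ultimately show ?thesis by (intro bexI[of _ \<Theta>]) (auto simp: less_eq_prod_def)
  qed
  show ?thesis
    unfolding Sup_prod_def
  proof (rule gen_congruenceI, unfold Mor_plus_on_directed_Union[OF assms(1) m(1)])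
    show "a \<in> Ob C \<and> b \<in> Ob C" if "(a, b) \<in> \<Union> (fst ` F)" for a b
      using that D(1)[of _ a b] by blast
    show "(a, a) \<in> \<Union> (fst ` F)" if "a \<in> Ob C" for a
      using that ne D(2)[of _ a] by blast
    show "(b, a) \<in> \<Union> (fst ` F)" if "(a, b) \<in> \<Union> (fst ` F)" for a b
      using that D(3)[of _ a b] by blast
    show "(a, d) \<in> \<Union> (fst ` F)"
      if "(a, b) \<in> \<Union> (fst ` F)" "(b, d) \<in> \<Union> (fst ` F)" for a b d
    proof -
      have "\<exists>\<Psi>\<in>F. {(a, b), (b, d)} \<subseteq> fst \<Psi> \<and> {} \<subseteq> snd \<Psi>"
        by (rule joint) (use that in simp_all)
      then obtain \<Psi> where \<Psi>: "\<Psi> \<in> F" "{(a, b), (b, d)} \<subseteq> fst \<Psi> \<and> {} \<subseteq> snd \<Psi>" by (rule bexE)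
      show ?thesis
        by (rule UN_I[OF \<Psi>(1)], rule D(4)[OF \<Psi>(1), of a b d]) (use \<Psi>(2) in simp_all)
    qed
    show "fs \<in> (\<Union>\<Psi>\<in>F. Mor_plus_on C (fst \<Psi>)) \<and> gs \<in> (\<Union>\<Psi>\<in>F. Mor_plus_on C (fst \<Psi>))"
      if "(fs, gs) \<in> \<Union> (snd ` F)" for fs gs
      using that D(5)[of _ fs gs] by blast
    show "(fs, fs) \<in> \<Union> (snd ` F)"
      if "fs \<in> (\<Union>\<Psi>\<in>F. Mor_plus_on C (fst \<Psi>))" for fs
      using that D(6)[of _ fs] by blast
    show "(gs, fs) \<in> \<Union> (snd ` F)" if "(fs, gs) \<in> \<Union> (snd ` F)" for fs gs
      using that D(7)[of _ fs gs] by blast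
    show "(fs, hs) \<in> \<Union> (snd ` F)"
      if "(fs, gs) \<in> \<Union> (snd ` F)" "(gs, hs) \<in> \<Union> (snd ` F)" for fs gs hs
    proof -
      have "\<exists>\<Psi>\<in>F. {} \<subseteq> fst \<Psi> \<and> {(fs, gs), (gs, hs)} \<subseteq> snd \<Psi>"
        by (rule joint) (use that in simp_all)
      then obtain \<Psi> where \<Psi>: "\<Psi> \<in> F" "{} \<subseteq> fst \<Psi> \<and> {(fs, gs), (gs, hs)} \<subseteq> snd \<Psi>" by (rule bexE)
      show ?thesis
        by (rule UN_I[OF \<Psi>(1)], rule D(8)[OF \<Psi>(1), of fs gs hs]) (use \<Psi>(2) in simp_all)
    qed
    show "([ident C a], [ident C b]) \<in> \<Union> (snd ` F)"
      if "(a, b) \<in> \<Union> (fst ` F)" for a b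
      using that D(9)[of _ a b] by blast
    show "([f, g], [cmp C g f]) \<in> \<Union> (snd ` F)"
      if "f \<in> Mor C" "g \<in> Mor C" "sc C g = tg C f" for f g
      using that ne D(10)[of _ f g] by blast
    show "(sc C (hd fs), sc C (hd gs)) \<in> \<Union> (fst ` F)"
      if "(fs, gs) \<in> \<Union> (snd ` F)" for fs gs
      using that D(11)[of _ fs gs] by blast
    show "(tg C (last fs), tg C (last gs)) \<in> \<Union> (fst ` F)"
      if "(fs, gs) \<in> \<Union> (snd ` F)" for fs gs
      using that D(12)[of _ fs gs] by blast
    show "(fs @ gs, fs' @ gs') \<in> \<Union> (snd ` F)"
      if "(fs, fs') \<in> \<Union> (snd ` F)" "(gs, gs') \<in> \<Union> (snd ` F)"
        "(tg C (last fs), sc C (hd gs)) \<in> \<Union> (fst ` F)" for fs fs' gs gs'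
    proof -
      have "\<exists>\<Psi>\<in>F. {(tg C (last fs), sc C (hd gs))} \<subseteq> fst \<Psi> \<and>
        {(fs, fs'), (gs, gs')} \<subseteq> snd \<Psi>"
        by (rule joint) (use that in simp_all)
      then obtain \<Psi> where \<Psi>: "\<Psi> \<in> F" "{(tg C (last fs), sc C (hd gs))} \<subseteq> fst \<Psi> \<and>
        {(fs, fs'), (gs, gs')} \<subseteq> snd \<Psi>" by (rule bexE)
      show ?thesis
        by (rule UN_I[OF \<Psi>(1)], rule D(13)[OF \<Psi>(1), of fs fs' gs gs']) (use \<Psi>(2) in simp_all)
    qed
  qed
qed

section \<open>The lattice of generalized congruences\<close>

text \<open>Pairs of relations with exactly one related pair in all: they generate the lattice of all pairs
  of relations and are inaccessible by arbitrary suprema, because a related pair of a union is a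
  related pair of one of its members.\<close>

definition singleton_rel_pairs :: "('o, 'm) rel_pair set" where
  "singleton_rel_pairs = range (\<lambda>p. ({p}, {})) \<union> range (\<lambda>q. ({}, {q}))"

lemma singleton_rel_pairs_join_prime:
  fixes k :: "('o, 'm) rel_pair"
  assumes k: "k \<in> singleton_rel_pairs" and le: "k \<le> Sup D"
  shows "\<exists>d\<in>D. k \<le> d"
proof -
  consider p where "k = ({p}, {})" | q where "k = ({}, {q})"
    using k unfolding singleton_rel_pairs_def by blast
  then show ?thesis
  proof cases
    case 1
    then have "p \<in> (\<Union>d\<in>D. fst d)" using le by (simp add: less_eq_prod_def fst_Sup)
    then show ?thesis unfolding 1 less_eq_prod_def by simp
  next
    case 2
    then have "q \<in> (\<Union>d\<in>D. snd d)" using le by (simp add: less_eq_prod_def snd_Sup)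
    then show ?thesis unfolding 2 less_eq_prod_def by simp
  qed
qed

lemma singleton_rel_pairs_generating:
  fixes x :: "('o, 'm) rel_pair"
  shows "x \<le> Sup {k \<in> singleton_rel_pairs. k \<le> x}"
proof -
  have "\<exists>k\<in>singleton_rel_pairs. k \<le> x \<and> p \<in> fst k" if "p \<in> fst x" for p
    using that by (intro bexI[of _ "({p}, {})"]) (auto simp: singleton_rel_pairs_def less_eq_prod_def)
  moreover have "\<exists>k\<in>singleton_rel_pairs. k \<le> x \<and> q \<in> snd k" if "q \<in> snd x" for q
    using that by (intro bexI[of _ "({}, {q})"]) (auto simp: singleton_rel_pairs_def less_eq_prod_def)
  ultimately show ?thesis
    unfolding less_eq_prod_def[of x] fst_Sup snd_Sup by blast
qed

theorem proposition2p28: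
  fixes C :: "('o, 'm) category_data"
  assumes "category C"
  shows "(nabla C \<in> GCgr C \<and> (\<forall>\<Psi> \<in> GCgr C. \<Psi> \<le> nabla C)) \<and>
    (\<forall>F. F \<noteq> {} \<and> F \<subseteq> GCgr C \<longrightarrow> Inf F \<in> GCgr C) \<and>
    (\<forall>F. F \<noteq> {} \<and> F \<subseteq> GCgr C \<and> directed F \<longrightarrow> Sup F \<in> GCgr C) \<and>
    algebraic_lattice (GCgr_order C)"
proof -
  have greatest: "nabla C \<in> GCgr C" "\<And>\<Psi>. \<Psi> \<in> GCgr C \<Longrightarrow> \<Psi> \<le> nabla C"
    using nabla_gen_congruence[OF assms] gen_congruence_le_nabla by (auto simp: GCgr_def)
  have Inf_closed: "Inf F \<in> GCgr C" if "F \<noteq> {}" "F \<subseteq> GCgr C" for F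
    using that Inf_gen_congruence[of F C] by (auto simp: GCgr_def)
  have Sup_closed: "Sup F \<in> GCgr C" if "directed F" "F \<subseteq> GCgr C" for F
    using that Sup_directed_gen_congruence[of F C] by (auto simp: GCgr_def)
  have "algebraic_lattice (GCgr_order C)"
    unfolding GCgr_order_def
    by (rule algebraic_latticeI[OF greatest Inf_closed Sup_closed
          singleton_rel_pairs_join_prime singleton_rel_pairs_generating])
  then show ?thesis using greatest Inf_closed Sup_closed by blast
qed

end
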